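(* Let $$P(\xi,z,\zeta)=P_0(z,\zeta)+P_1(z,\zeta)\xi+\dots+P_p(z,\zeta)\xi^p\qquad (z\in D,\ \xi,\zeta\in\mathbb{C})$$ be a polynomial in the two variables $(\xi,\zeta)$ with coefficients in $\mathbb{E}$ depending on $z$, of order $p$ with respect to $\xi$, and let $\hat{f}(\varepsilon,z)=\sum_{n=0}^\infty f_n(z)\varepsilon^n\in\mathbb{E}[[\varepsilon]]$. Let $\hat{x}(\varepsilon,z)=\sum_{n=0}^\infty x_n(z)\varepsilon^n\in\mathbb{E}[[\varepsilon]]$. Then $\hat{x}$ is a formal power series solution of the singularly perturbed equation $$P\left(\varepsilon,z,\frac{d}{dz}\right)\hat{x}(\varepsilon,z)=\hat{f}(\varepsilon,z)$$ if and only if its Borel transform $\hat{y}(\varepsilon,z):=\hat{\mathcal{B}}_{1,\varepsilon}\hat{x}(\varepsilon,z)$ is a formal solution of the Cauchy problem $$\begin{cases}Q(\partial_\varepsilon,z,\partial_z)\hat{y}(\varepsilon,z)=\hat{F}(\varepsilon,z)\\ \partial_\varepsilon^n\hat{y}(0,z)=x_n(z)\quad\text{for } n=0,1,\dots,p-1,\end{cases}$$ where $Q(\chi,z,\zeta):=\chi^pP(\chi^{-1},z,\zeta)$, $\hat{F}(\varepsilon,z):=\partial_\varepsilon^p\hat{\mathcal{B}}_{1,\varepsilon}\hat{f}(\varepsilon,z)$, and the functions $x_0(z),\dots,x_{p-1}(z)$ satisfy the equations $$P_n\left(z,\frac{d}{dz}\right)x_0(z)+P_{n-1}\left(z,\frac{d}{dz}\right)x_1(z)+\dots+P_0\left(z,\frac{d}{dz}\right)x_n(z)=f_n(z)\quad\text{for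 } n=0,\dots,p-1.$$
   Context: $D$ is an open disc centred at $0\in\mathbb{C}$. Here $\mathbb{E}$ is the space $\mathcal{O}$ of functions of $z$ holomorphic on a disc $D_r$ and continuous on its closure for some $r>0$ (sup norm; the radius is not prescribed and may be decreased if necessary), and $\mathbb{E}[[\varepsilon]]$ is the space of formal power series in $\varepsilon$ with coefficients in $\mathbb{E}$. In $P_j(z,\frac{d}{dz})$ a monomial $c(z)\zeta^i$ is replaced by the operator $c(z)\frac{d^i}{dz^i}$, acting on coefficients of series in $\varepsilon$. The formal Borel transform is $\hat{\mathcal{B}}_{1,\varepsilon}\left(\sum_{n\ge0}u_n\varepsilon^n\right)=\sum_{n\ge0}\frac{u_n}{n!}\varepsilon^n$; $\partial_\varepsilon$ is formal differentiation in $\varepsilon$. The requirement that $x_0,\dots,x_{p-1}$ satisfy the displayed equations is part of the right-hand side of the equivalence. *)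

theory Defs
  imports "HOL-Complex_Analysis.Complex_Analysis"
begin

(* The space E.  Its elements are functions holomorphic on some disc about 0 and continuous on
   the closure; since the radius may be decreased at will, two of them are the same element
   when they agree on some disc about 0. *)

definition holo_on_disc :: "real \<Rightarrow> (complex \<Rightarrow> complex) set" where
  "holo_on_disc r = {u. u holomorphic_on ball 0 r \<and> continuous_on (cball 0 r) u}"

definition holo_near_0 :: "(complex \<Rightarrow> complex) set" where
  "holo_near_0 = (\<Union>r\<in>{0<..}. holo_on_disc r)"

definition eq_near_0 :: "(complex \<Rightarrow> complex) \<Rightarrow> (complex \<Rightarrow> complex) \<Rightarrow> bool" where
  "eq_near_0 u v \<longleftrightarrow>
     u \<in> holo_near_0 \<and> v \<in> holo_near_0 \<and> (\<exists>r>0. \<forall>z\<in>ball 0 r. u z = v z)"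

lemma holo_near_0_iff: "u \<in> holo_near_0 \<longleftrightarrow> (\<exists>r>0. u holomorphic_on ball 0 r)"
proof
  assume "\<exists>r>0. u holomorphic_on ball 0 r"
  then obtain r where r: "r > 0" "u holomorphic_on ball 0 r" by blast
  have "cball 0 (r/2) \<subseteq> ball (0::complex) r" "ball 0 (r/2) \<subseteq> ball (0::complex) r"
    using r(1) by auto
  then have "u \<in> holo_on_disc (r/2)"
    unfolding holo_on_disc_def
    using r(2) holomorphic_on_subset holomorphic_on_imp_continuous_on by blast
  then show "u \<in> holo_near_0"
    unfolding holo_near_0_def using r(1) by (auto intro!: bexI[of _ "r/2"])
qed (auto simp: holo_near_0_def holo_on_disc_def)

lemma eq_near_0_iff:
  "eq_near_0 u v \<longleftrightarrow>
     u \<in> holo_near_0 \<and> v \<in> holo_near_0 \<and> (\<forall>\<^sub>F z in nhds 0. u z = v z)"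
  by (simp add: eq_near_0_def eventually_nhds_metric dist_commute Ball_def)

lemma holo_near_0_common:
  assumes "u \<in> holo_near_0" "v \<in> holo_near_0"
  obtains r where "r > 0" "u holomorphic_on ball 0 r" "v holomorphic_on ball 0 r"
proof -
  obtain r s where "r > 0" "u holomorphic_on ball 0 r" "s > 0" "v holomorphic_on ball 0 s"
    using assms by (auto simp: holo_near_0_iff)
  then show thesis
    by (intro that[of "min r s"]) (auto intro: holomorphic_on_subset)
qed

lemma holo_near_0_const: "(\<lambda>_. c) \<in> holo_near_0"
  by (auto simp: holo_near_0_iff intro!: exI[of _ 1])

lemma holo_near_0_add: "u \<in> holo_near_0 \<Longrightarrow> v \<in> holo_near_0 \<Longrightarrow> (\<lambda>z. u z + v z) \<in> holo_near_0"
  by (erule holo_near_0_common, assumption) (auto simp: holo_near_0_iff intro!: holomorphic_intros)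

lemma holo_near_0_diff: "u \<in> holo_near_0 \<Longrightarrow> v \<in> holo_near_0 \<Longrightarrow> (\<lambda>z. u z - v z) \<in> holo_near_0"
  by (erule holo_near_0_common, assumption) (auto simp: holo_near_0_iff intro!: holomorphic_intros)

lemma holo_near_0_mult: "u \<in> holo_near_0 \<Longrightarrow> v \<in> holo_near_0 \<Longrightarrow> (\<lambda>z. u z * v z) \<in> holo_near_0"
  by (erule holo_near_0_common, assumption) (auto simp: holo_near_0_iff intro!: holomorphic_intros)

lemma holo_near_0_uminus: "u \<in> holo_near_0 \<Longrightarrow> (\<lambda>z. - u z) \<in> holo_near_0"
  by (auto simp: holo_near_0_iff intro!: holomorphic_intros)

lemma holo_near_0_scaleR: "u \<in> holo_near_0 \<Longrightarrow> (\<lambda>z. c *\<^sub>R u z) \<in> holo_near_0"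
  by (auto simp: holo_near_0_iff scaleR_conv_of_real intro!: holomorphic_intros)

lemma holo_near_0_deriv: "u \<in> holo_near_0 \<Longrightarrow> deriv u \<in> holo_near_0"
  by (auto simp: holo_near_0_iff intro!: holomorphic_deriv)

(* For functions living on one and the same disc the identification below collapses nothing. *)
lemma eq_near_0_on_disc:
  assumes "r > 0" "u \<in> holo_on_disc r" "v \<in> holo_on_disc r"
  shows "eq_near_0 u v \<longleftrightarrow> (\<forall>z\<in>ball 0 r. u z = v z)"
proof
  assume "eq_near_0 u v"
  then obtain s where s: "s > 0" "\<forall>z\<in>ball 0 s. u z = v z"
    by (auto simp: eq_near_0_def)
  have "u z = v z" if "z \<in> ball 0 r" for z
  proof (rule analytic_continuation_open[of "ball 0 (min r s)" "ball 0 r" u v z])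
    show "ball (0::complex) (min r s) \<noteq> {}" using assms(1) s(1) by simp
  qed (use assms s that in \<open>auto simp: holo_on_disc_def\<close>)
  then show "\<forall>z\<in>ball 0 r. u z = v z" by blast
next
  assume "\<forall>z\<in>ball 0 r. u z = v z"
  moreover have "u \<in> holo_near_0" "v \<in> holo_near_0"
    unfolding holo_near_0_def using assms by (blast intro: greaterThan_iff[THEN iffD2])+
  ultimately show "eq_near_0 u v"
    unfolding eq_near_0_def using assms(1) by blast
qed

lemma eq_near_0_map:
  assumes "eq_near_0 u v" "\<And>w. w \<in> holo_near_0 \<Longrightarrow> (\<lambda>z. h (w z)) \<in> holo_near_0"
  shows "eq_near_0 (\<lambda>z. h (u z)) (\<lambda>z. h (v z))"
proof -
  have "\<forall>\<^sub>F z in nhds 0. u z = v z" using assms(1) by (simp add: eq_near_0_iff)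
  then have "\<forall>\<^sub>F z in nhds 0. h (u z) = h (v z)" by eventually_elim simp
  with assms show ?thesis by (simp add: eq_near_0_iff)
qed

lemma eq_near_0_map2:
  assumes "eq_near_0 u v" "eq_near_0 u' v'"
    "\<And>w w'. w \<in> holo_near_0 \<Longrightarrow> w' \<in> holo_near_0 \<Longrightarrow> (\<lambda>z. h (w z) (w' z)) \<in> holo_near_0"
  shows "eq_near_0 (\<lambda>z. h (u z) (u' z)) (\<lambda>z. h (v z) (v' z))"
proof -
  have "\<forall>\<^sub>F z in nhds 0. u z = v z" "\<forall>\<^sub>F z in nhds 0. u' z = v' z"
    using assms(1,2) by (simp_all add: eq_near_0_iff)
  then have "\<forall>\<^sub>F z in nhds 0. h (u z) (u' z) = h (v z) (v' z)" by eventually_elim simp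
  with assms show ?thesis by (simp add: eq_near_0_iff)
qed

lemma eq_near_0_deriv:
  assumes "eq_near_0 u v"
  shows "eq_near_0 (deriv u) (deriv v)"
proof -
  have "\<forall>\<^sub>F z in nhds 0. u z = v z" using assms by (simp add: eq_near_0_iff)
  then have "\<forall>\<^sub>F y in nhds 0. \<forall>\<^sub>F z in nhds y. u z = v z"
    by (simp add: eventually_eventually)
  then have "\<forall>\<^sub>F y in nhds 0. deriv u y = deriv v y"
    by eventually_elim (rule deriv_cong_ev, simp_all)
  with assms show ?thesis by (simp add: eq_near_0_iff holo_near_0_deriv)
qed

quotient_type holo = "complex \<Rightarrow> complex" / partial: eq_near_0
proof (rule part_equivpI)
  show "\<exists>u. eq_near_0 u u"
    using holo_near_0_const[of 0] by (auto simp: eq_near_0_iff)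
  show "symp eq_near_0"
    by (auto simp: symp_def eq_near_0_def)
  show "transp eq_near_0"
  proof (rule transpI)
    fix u v w assume uv: "eq_near_0 u v" and vw: "eq_near_0 v w"
    then have "\<forall>\<^sub>F z in nhds 0. u z = v z" "\<forall>\<^sub>F z in nhds 0. v z = w z"
      by (simp_all add: eq_near_0_iff)
    then have "\<forall>\<^sub>F z in nhds 0. u z = w z" by eventually_elim simp
    with uv vw show "eq_near_0 u w" by (simp add: eq_near_0_iff)
  qed
qed

instantiation holo :: "{comm_ring_1, real_algebra_1}"
begin

lift_definition zero_holo :: holo is "\<lambda>_. 0"
  by (simp add: eq_near_0_iff holo_near_0_const)

lift_definition one_holo :: holo is "\<lambda>_. 1"
  by (simp add: eq_near_0_iff holo_near_0_const)

lift_definition plus_holo :: "holo \<Rightarrow> holo \<Rightarrow> holo" is "\<lambda>u v z. u z + v z"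
  by (rule eq_near_0_map2[where h = "(+)"]) (assumption | rule holo_near_0_add)+

lift_definition minus_holo :: "holo \<Rightarrow> holo \<Rightarrow> holo" is "\<lambda>u v z. u z - v z"
  by (rule eq_near_0_map2[where h = "(-)"]) (assumption | rule holo_near_0_diff)+

lift_definition uminus_holo :: "holo \<Rightarrow> holo" is "\<lambda>u z. - u z"
  by (rule eq_near_0_map[where h = uminus]) (assumption | rule holo_near_0_uminus)+

lift_definition times_holo :: "holo \<Rightarrow> holo \<Rightarrow> holo" is "\<lambda>u v z. u z * v z"
  by (rule eq_near_0_map2[where h = "(*)"]) (assumption | rule holo_near_0_mult)+

lift_definition scaleR_holo :: "real \<Rightarrow> holo \<Rightarrow> holo" is "\<lambda>c u z. c *\<^sub>R u z"
  subgoal for c by (rule eq_near_0_map[where h = "scaleR c"]) (assumption | rule holo_near_0_scaleR)+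
  done

instance
proof
  have "\<not> eq_near_0 (\<lambda>_. 0) (\<lambda>_. 1)"
    by (auto simp: eq_near_0_def intro: exI[of _ 0])
  then show "(0::holo) \<noteq> 1"
    by transfer
qed (transfer, simp add: eq_near_0_iff holo_near_0_const holo_near_0_add holo_near_0_diff
       holo_near_0_uminus holo_near_0_mult holo_near_0_scaleR algebra_simps)+

end

lift_definition d_dz :: "holo \<Rightarrow> holo" is deriv
  by (rule eq_near_0_deriv)

(* A polynomial in \<zeta> with coefficients in E is a value of type holo poly, and a polynomial
   in \<xi> and \<zeta> one of type holo poly poly, the outer variable being \<xi>: coeff P j is
   P_j.  Formal power series in \<epsilon> are values of type holo fps. *)

definition diff_op :: "holo poly \<Rightarrow> holo \<Rightarrow> holo" where
  "diff_op c u = (\<Sum>i\<le>degree c. coeff c i * (d_dz ^^ i) u)"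

definition diff_op_fps :: "holo poly \<Rightarrow> holo fps \<Rightarrow> holo fps" where
  "diff_op_fps c x = Abs_fps (\<lambda>n. diff_op c (fps_nth x n))"

(* P(\<epsilon>, z, d/dz), with \<xi> replaced by multiplication by \<epsilon> *)
definition perturbed_op :: "holo poly poly \<Rightarrow> holo fps \<Rightarrow> holo fps" where
  "perturbed_op P x = (\<Sum>j\<le>degree P. fps_X ^ j * diff_op_fps (coeff P j) x)"

(* Q(\<partial>_\<epsilon>, z, \<partial>_z), with \<chi> replaced by formal differentiation in \<epsilon> *)
definition cauchy_op :: "holo poly poly \<Rightarrow> holo fps \<Rightarrow> holo fps" where
  "cauchy_op Q y = (\<Sum>j\<le>degree Q. diff_op_fps (coeff Q j) ((fps_deriv ^^ j) y))"

definition formal_borel :: "holo fps \<Rightarrow> holo fps" where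
  "formal_borel u = Abs_fps (\<lambda>n. (1 / fact n) *\<^sub>R fps_nth u n)"

end

theory Submission
  imports Defs
begin

text \<open>
  The Borel transform turns the left shift of power series into \<open>\<partial>\<^sub>\<epsilon>\<close> and commutes
  with operators acting on coefficients. Hence the Cauchy equation is the Borel transform of
  the singularly perturbed equation with its first \<open>p\<close> coefficients dropped; these are exactly
  the compatibility equations on \<open>x\<^sub>0, \<dots>, x\<^bsub>p-1\<^esub>\<close>.
\<close>

text \<open>Linearity of \<open>deriv\<close> rests on differentiability, which a representative has
  on some disc about 0; equality in \<open>holo\<close> is tested on such a disc.\<close>

lemma d_dz_scaleR: "d_dz (c *\<^sub>R u) = c *\<^sub>R d_dz u"
proof transfer
  fix c :: real and u :: "complex \<Rightarrow> complex"
  assume "eq_near_0 u u"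
  then have u: "u \<in> holo_near_0"
    by (simp add: eq_near_0_iff)
  then obtain r where r: "r > 0" "u holomorphic_on ball 0 r"
    by (auto simp: holo_near_0_iff)
  have "deriv (\<lambda>z. c *\<^sub>R u z) z = c *\<^sub>R deriv u z" if "z \<in> ball 0 r" for z
    using holomorphic_on_imp_differentiable_at[OF r(2) _ that]
    by (simp add: scaleR_conv_of_real)
  with r(1) show "eq_near_0 (deriv (\<lambda>z. c *\<^sub>R u z)) (\<lambda>z. c *\<^sub>R deriv u z)"
    unfolding eq_near_0_def
    by (blast intro: holo_near_0_deriv holo_near_0_scaleR u)
qed

lemma funpow_d_dz_scaleR: "(d_dz ^^ i) (c *\<^sub>R u) = c *\<^sub>R (d_dz ^^ i) u"
  by (induction i) (simp_all add: d_dz_scaleR)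

lemma diff_op_scaleR: "diff_op a (c *\<^sub>R u) = c *\<^sub>R diff_op a u"
  by (simp add: diff_op_def funpow_d_dz_scaleR scaleR_sum_right)

lemma diff_op_fps_nth [simp]: "fps_nth (diff_op_fps a u) n = diff_op a (fps_nth u n)"
  by (simp add: diff_op_fps_def)

lemma formal_borel_nth [simp]: "fps_nth (formal_borel u) n = (1 / fact n) *\<^sub>R fps_nth u n"
  by (simp add: formal_borel_def)

lemma diff_op_fps_0_left [simp]: "diff_op_fps 0 u = 0"
  by (rule fps_ext) (simp add: diff_op_def)

lemma diff_op_fps_formal_borel: "diff_op_fps a (formal_borel u) = formal_borel (diff_op_fps a u)"
  by (rule fps_ext) (simp add: diff_op_scaleR)

text \<open>The factors \<open>1 / fact n\<close> are nonzero. This injectivity lets the Cauchy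
  equation be pulled back through the transform.\<close>

lemma formal_borel_inject [simp]: "formal_borel u = formal_borel v \<longleftrightarrow> u = v"
  by (simp add: fps_eq_iff)

lemma formal_borel_sum: "formal_borel (\<Sum>i\<in>A. u i) = (\<Sum>i\<in>A. formal_borel (u i))"
  by (rule fps_ext) (simp add: fps_sum_nth scaleR_sum_right)

text \<open>The factor \<open>n + 1\<close> produced by differentiation turns
  \<open>1 / fact (n + 1)\<close> into \<open>1 / fact n\<close>.\<close>

lemma fps_deriv_formal_borel: "fps_deriv (formal_borel u) = formal_borel (fps_shift 1 u)"
proof (rule fps_ext)
  fix n
  have "fps_nth (fps_deriv (formal_borel u)) n
      = of_real (real (n + 1)) * ((1 / fact (n + 1)) *\<^sub>R fps_nth u (n + 1))"
    by (simp only: fps_deriv_nth formal_borel_nth of_real_of_nat_eq)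
  also have "\<dots> = (real (n + 1) * (1 / fact (n + 1))) *\<^sub>R fps_nth u (n + 1)"
    by (simp only: scaleR_scaleR flip: scaleR_conv_of_real)
  also have "real (n + 1) * (1 / fact (n + 1)) = 1 / fact n"
    by (simp add: divide_simps del: of_nat_Suc)
  finally show "fps_nth (fps_deriv (formal_borel u)) n
      = fps_nth (formal_borel (fps_shift 1 u)) n"
    by simp
qed

lemma funpow_fps_deriv_formal_borel:
  "(fps_deriv ^^ n) (formal_borel u) = formal_borel (fps_shift n u)"
proof (induction n)
  case (Suc n)
  have "fps_shift 1 (fps_shift n u) = fps_shift (Suc n) u"
    by (rule fps_ext) simp
  with Suc show ?case
    by (simp add: fps_deriv_formal_borel)
qed simp

text \<open>A Cauchy product in \<epsilon>, arranged to match the compatibility equations.\<close>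

lemma perturbed_op_nth:
  "fps_nth (perturbed_op P x) n = (\<Sum>k\<le>n. diff_op (coeff P (n - k)) (fps_nth x k))"
proof -
  have "fps_nth (perturbed_op P x) n
      = (\<Sum>j\<le>degree P. if j \<le> n then diff_op (coeff P j) (fps_nth x (n - j)) else 0)"
    by (auto simp: perturbed_op_def fps_sum_nth fps_X_power_mult_nth intro!: sum.cong)
  \<comment> \<open>Terms with \<open>j > n\<close> vanish by the conditional, those with
    \<open>j > degree P\<close> by the zero coefficient.\<close>
  also have "\<dots> = (\<Sum>j\<le>n. diff_op (coeff P j) (fps_nth x (n - j)))"
    by (rule sum.mono_neutral_cong) (auto simp: coeff_eq_0 diff_op_def)
  also have "\<dots> = (\<Sum>k\<le>n. diff_op (coeff P (n - k)) (fps_nth x k))"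
    by (rule sum.reindex_bij_witness[of _ "\<lambda>k. n - k" "\<lambda>k. n - k"]) auto
  finally show ?thesis .
qed

text \<open>Reversal pairs \<open>coeff P (p - j)\<close> with the shift by \<open>j\<close>, where
  \<open>p = degree P\<close>. Substituting \<open>k = n + j\<close> gives the convolution for order
  \<open>n + p\<close>.\<close>

lemma cauchy_op_formal_borel:
  "cauchy_op (reflect_poly P) (formal_borel x)
     = formal_borel (fps_shift (degree P) (perturbed_op P x))"
proof -
  let ?p = "degree P"
  \<comment> \<open>The degree of \<open>reflect_poly P\<close> drops below that of \<open>P\<close> when \<open>P\<^sub>0 = 0\<close>.\<close>
  have "cauchy_op (reflect_poly P) (formal_borel x)
      = (\<Sum>j\<le>?p. diff_op_fps (coeff (reflect_poly P) j) ((fps_deriv ^^ j) (formal_borel x)))"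
    unfolding cauchy_op_def
    by (rule sum.mono_neutral_left) (auto simp: degree_reflect_poly_le coeff_eq_0 intro: order.trans)
  also have "\<dots> = formal_borel (\<Sum>j\<le>?p. diff_op_fps (coeff P (?p - j)) (fps_shift j x))"
    by (simp add: funpow_fps_deriv_formal_borel diff_op_fps_formal_borel formal_borel_sum
        coeff_reflect_poly)
  also have "(\<Sum>j\<le>?p. diff_op_fps (coeff P (?p - j)) (fps_shift j x))
      = fps_shift ?p (perturbed_op P x)"
  proof (rule fps_ext)
    fix n
    have "fps_nth (\<Sum>j\<le>?p. diff_op_fps (coeff P (?p - j)) (fps_shift j x)) n
        = (\<Sum>j\<le>?p. diff_op (coeff P (?p - j)) (fps_nth x (n + j)))"
      by (simp add: fps_sum_nth)
    also have "\<dots> = (\<Sum>k\<in>{n..n + ?p}. diff_op (coeff P (n + ?p - k)) (fps_nth x k))"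
      by (rule sum.reindex_bij_witness[of _ "\<lambda>k. k - n" "\<lambda>j. n + j"]) auto
    \<comment> \<open>For \<open>k < n\<close> the index \<open>n + ?p - k\<close> exceeds the
      degree of \<open>P\<close>, so the added terms are zero.\<close>
    also have "\<dots> = (\<Sum>k\<le>n + ?p. diff_op (coeff P (n + ?p - k)) (fps_nth x k))"
      by (rule sum.mono_neutral_left) (auto simp: coeff_eq_0 diff_op_def)
    finally show "fps_nth (\<Sum>j\<le>?p. diff_op_fps (coeff P (?p - j)) (fps_shift j x)) n
        = fps_nth (fps_shift ?p (perturbed_op P x)) n"
      by (simp add: perturbed_op_nth)
  qed
  finally show ?thesis .
qed

lemma fps_eq_iff_shift:
  "u = v \<longleftrightarrow> fps_shift p u = fps_shift p v \<and> (\<forall>n<p. fps_nth u n = fps_nth v n)"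
proof (intro iffI fps_ext)
  fix n
  assume eq: "fps_shift p u = fps_shift p v \<and> (\<forall>n<p. fps_nth u n = fps_nth v n)"
  \<comment> \<open>The index \<open>n - p + p\<close> equals \<open>n\<close> when
    \<open>p \<le> n\<close>; orders below \<open>p\<close> come from the second conjunct.\<close>
  then have "fps_nth u (n - p + p) = fps_nth v (n - p + p)"
    by (metis fps_shift_nth)
  with eq show "fps_nth u n = fps_nth v n"
    by (cases "n < p") simp_all
qed simp

theorem theorem3:
  fixes P :: "holo poly poly" and p :: nat and f x :: "holo fps"
  assumes "degree P = p"
  shows "perturbed_op P x = f \<longleftrightarrow>
    (let Q = reflect_poly P;
         y = formal_borel x;
         F = (fps_deriv ^^ p) (formal_borel f)
     in cauchy_op Q y = F \<and>
        (\<forall>n<p. fps_nth ((fps_deriv ^^ n) y) 0 = fps_nth x n) \<and>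
        (\<forall>n<p. (\<Sum>k\<le>n. diff_op (coeff P (n - k)) (fps_nth x k)) = fps_nth f n))"
  unfolding Let_def fps_eq_iff_shift[of "perturbed_op P x" f p]
  \<comment> \<open>The initial conditions hold by construction: the constant coefficient of
    \<open>formal_borel (fps_shift n x)\<close> is \<open>fps_nth x n\<close>, as
    \<open>fact 0 = 1\<close>.\<close>
  by (simp add: cauchy_op_formal_borel funpow_fps_deriv_formal_borel perturbed_op_nth
      flip: assms)

end
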